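(* Let $\mathcal{N}$ be a neural network with $L$ layers, let $\mathcal{D}_{train}=\{(\mathsf{in},\mathsf{lb})\}$ be the training data set, let $\Delta=(\Delta_1,\dots,\Delta_{d_L})$ with all $\Delta_j\ge 0$ be the output tolerance, let $\tilde{l}\in\{1,\dots,L\}$ and $\kappa\ge 0$. Suppose the symbolic tolerance loss satisfies $E^{(\Delta,\tilde{l},\kappa)}_{train}=0$. Then for every input $\mathsf{in}'\in\mathbb{R}^{d_0}$: if there exists a training pair $(\mathsf{in},\mathsf{lb})\in\mathcal{D}_{train}$ such that $$f^{(\tilde{l}-1)}(\mathsf{in}')\in\left[f^{(\tilde{l}-1)}(\mathsf{in})\oplus(-\kappa),\; f^{(\tilde{l}-1)}(\mathsf{in})\oplus\kappa\right],$$ then $$f^{(L)}(\mathsf{in}')\in\left[\mathsf{lb}\oplus(-\Delta),\; \mathsf{lb}\oplus\Delta\right].$$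
   Context: A neural network $\mathcal{N}$ with $L$ layers is a sequence of functions $g^{(l)}:\mathbb{R}^{d_{l-1}}\to\mathbb{R}^{d_l}$, $l=1,\dots,L$. For $\mathsf{in}\in\mathbb{R}^{d_0}$, $f^{(l)}(\mathsf{in}):=g^{(l)}(\ldots g^{(2)}(g^{(1)}(\mathsf{in})))$, with $f^{(0)}(\mathsf{in}):=\mathsf{in}$. Subscripts denote vector components. The training set $\mathcal{D}_{train}$ is a finite nonempty set of pairs $(\mathsf{in},\mathsf{lb})\in\mathbb{R}^{d_0}\times\mathbb{R}^{d_L}$. For a vector $v$, $v\oplus c$ adds $c$ to every component of $v$ if $c$ is a scalar, and is componentwise addition if $c$ is a vector. For vectors $v,w$ of the same dimension, $[v,w]$ denotes the box $\{x: v_i\le x_i\le w_i \text{ for all } i\}$. Output bound: $[a,b]$ with $a,b\in\mathbb{R}^{d_L}$ is an output bound for $\mathsf{in}$ subject to $(\tilde{l},\kappa)$-perturbation if for every $\mathsf{fv}\in[f^{(\tilde{l}-1)}(\mathsf{in})\oplus(-\kappa),\,f^{(\tilde{l}-1)}(\mathsf{in})\oplus\kappa]$ and every $j\in\{1,\dots,d_L\}$ one has $g^{(L)}_j(g^{(L-1)}(\ldots(g^{(\tilde{l})}(\mathsf{fv}))))\in[a_j,b_j]$. (It is only required to be an over-approximation of the set of perturbed outputs.) Symbolic loss: $e^{\langle \Delta,\tilde{l},\kappa\rangle}_{j}([a,b],\mathsf{lb}):=\mathrm{overflow}(I_1,I_2)$ with $I_1=[a_j,b_j]$ and $I_2=[\mathsf{lb}_j-\Delta_j,\mathsf{lb}_j+\Delta_j]$,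 where $$\mathrm{overflow}(I_1,I_2)=\sum_{m=1}^{n}\mathrm{dist}\left(\tfrac12(p_m+q_m),\,I_2\right).$$ Here the sum is over the maximal disjoint intervals (connected components) of the set difference $I_1\setminus I_2$, $p_m\le q_m$ are the lower and upper end-points of the $m$-th such interval (whether or not they belong to it), and $\mathrm{dist}(x,I_2)$ is the shortest distance between $x$ and the points of $I_2$. An empty sum is $0$. Symbolic tolerance loss: for each training pair $(\mathsf{in},\mathsf{lb})$ an output bound $[a,b]$ for $\mathsf{in}$ subject to $(\tilde{l},\kappa)$-perturbation is computed (any fixed choice of valid output bounds), and $$E^{(\Delta,\tilde{l},\kappa)}_{train}=\frac1N\sum_{(\mathsf{in},\mathsf{lb})\in\mathcal{D}_{train}}\ \sum_{j=1}^{d_L}\left(e^{\langle\Delta,\tilde{l},\kappa\rangle}_{j}([a,b],\mathsf{lb})\right)^2,\qquad N=|\mathcal{D}_{train}|,$$ where in each summand $[a,b]$ is the output bound computed for that $\mathsf{in}$. *)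

theory Defs
  imports
    "HOL-Analysis.Connected"
    "HOL-Analysis.Elementary_Metric_Spaces"
    "Jordan_Normal_Form.Matrix"
begin

text \<open>
  A vector in \<open>R^n\<close> is an element of \<^term>\<open>carrier_vec n :: real vec set\<close>; components are
  indexed by \<open>0, ..., n - 1\<close>.  The order on vectors is componentwise and requires equal
  dimensions, so the box \<open>[v, w]\<close> is the order interval \<^term>\<open>{v..w} :: real vec set\<close>.
\<close>

lemma vec_box_iff:
  fixes v w x :: "real vec"
  assumes "dim_vec v = dim_vec w"
  shows "x \<in> {v..w} \<longleftrightarrow>
    dim_vec x = dim_vec v \<and> (\<forall>i<dim_vec v. v $ i \<le> x $ i \<and> x $ i \<le> w $ i)"
  unfolding atLeastAtMost_iff less_eq_vec_def using assms by metis

definition shift :: "real vec \<Rightarrow> real \<Rightarrow> real vec" where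
  "shift v c = map_vec (\<lambda>x. x + c) v"

text \<open>Layer \<open>l\<close>, for \<open>l \<in> {1..L}\<close>, is \<open>g l\<close>; \<open>d l\<close> is the output dimension of layer \<open>l\<close>.\<close>

definition neural_network ::
    "nat \<Rightarrow> (nat \<Rightarrow> nat) \<Rightarrow> (nat \<Rightarrow> real vec \<Rightarrow> real vec) \<Rightarrow> bool" where
  "neural_network L d g \<longleftrightarrow> (\<forall>l\<in>{1..L}. g l \<in> carrier_vec (d (l - 1)) \<rightarrow> carrier_vec (d l))"

text \<open>\<open>layers g k m v = g m (\<dots> (g (k + 1) (g k v)))\<close>, which is \<open>v\<close> if \<open>m < k\<close>.\<close>

definition layers ::
    "(nat \<Rightarrow> real vec \<Rightarrow> real vec) \<Rightarrow> nat \<Rightarrow> nat \<Rightarrow> real vec \<Rightarrow> real vec" where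
  "layers g k m v = fold g [k..<Suc m] v"

definition net_out :: "(nat \<Rightarrow> real vec \<Rightarrow> real vec) \<Rightarrow> nat \<Rightarrow> real vec \<Rightarrow> real vec" where
  "net_out g l v = layers g 1 l v"

definition feature_box ::
    "(nat \<Rightarrow> real vec \<Rightarrow> real vec) \<Rightarrow> nat \<Rightarrow> real \<Rightarrow> real vec \<Rightarrow> real vec set" where
  "feature_box g l \<kappa> inp = {shift (net_out g (l - 1) inp) (- \<kappa>) .. shift (net_out g (l - 1) inp) \<kappa>}"

definition output_bound ::
    "nat \<Rightarrow> (nat \<Rightarrow> nat) \<Rightarrow> (nat \<Rightarrow> real vec \<Rightarrow> real vec) \<Rightarrow> nat \<Rightarrow> real \<Rightarrow>
      real vec \<Rightarrow> real vec \<Rightarrow> real vec \<Rightarrow> bool" where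
  "output_bound L d g l \<kappa> inp a b \<longleftrightarrow>
    a \<in> carrier_vec (d L) \<and> b \<in> carrier_vec (d L) \<and>
    (\<forall>fv \<in> feature_box g l \<kappa> inp. \<forall>j<d L. layers g l L fv $ j \<in> {a $ j .. b $ j})"

text \<open>
  Intended for closed intervals with \<open>I\<^sub>2\<close> nonempty.  Then \<open>I\<^sub>1 - I\<^sub>2\<close> has at most two
  components, each a bounded nonempty interval \<open>C\<close> with end-points \<open>Inf C\<close> and \<open>Sup C\<close>.
\<close>

definition overflow :: "real set \<Rightarrow> real set \<Rightarrow> real" where
  "overflow I\<^sub>1 I\<^sub>2 = (\<Sum>C\<in>components (I\<^sub>1 - I\<^sub>2). infdist ((Inf C + Sup C) / 2) I\<^sub>2)"

definition symbolic_loss ::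
    "real vec \<Rightarrow> nat \<Rightarrow> real vec \<Rightarrow> real vec \<Rightarrow> real vec \<Rightarrow> real" where
  "symbolic_loss \<Delta> j a b lb =
    overflow {a $ j .. b $ j} {lb $ j - \<Delta> $ j .. lb $ j + \<Delta> $ j}"

text \<open>
  \<open>a inp lb\<close> and \<open>b inp lb\<close> are the lower and upper corner of the output bound computed for the
  training pair \<open>(inp, lb)\<close>.  The perturbed layer and the perturbation size enter the loss only
  through these bounds; \<open>n\<close> is the output dimension.
\<close>

definition symbolic_tolerance_loss ::
    "nat \<Rightarrow> (real vec \<times> real vec) set \<Rightarrow> real vec \<Rightarrow>
      (real vec \<Rightarrow> real vec \<Rightarrow> real vec) \<Rightarrow> (real vec \<Rightarrow> real vec \<Rightarrow> real vec) \<Rightarrow> real" where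
  "symbolic_tolerance_loss n D \<Delta> a b =
    1 / real (card D) *
      (\<Sum>(inp, lb)\<in>D. \<Sum>j<n. (symbolic_loss \<Delta> j (a inp lb) (b inp lb) lb)\<^sup>2)"

end

(* Zero loss makes every overflow term vanish. If a point of the output bound [a_j, b_j] left the
   tolerance interval, its component in the difference would lie entirely on one side of that
   interval, and so would the midpoint of the component, at positive distance. Hence the whole output
   bound lies in the tolerance interval. *)
theory Submission
  imports Defs
begin

text \<open>A connected subset lies within a single component, so \<open>A\<close> and
  \<open>B\<close> contribute at most one component each. Finiteness matters because
  \<open>sum\<close> over an infinite set is 0 by default.\<close>

lemma finite_components_Un_connected:
  assumes "connected A" "connected B"
  shows "finite (components (A \<union> B))"
proof -
  let ?c = "connected_component_set (A \<union> B)"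
  have const: "?c ` X \<subseteq> {?c x}" if "connected X" "X \<subseteq> A \<union> B" "x \<in> X" for X x
  proof
    fix C assume "C \<in> ?c ` X"
    then obtain y where "y \<in> X" "C = ?c y" by blast
    moreover have "connected_component (A \<union> B) x y"
      using that \<open>y \<in> X\<close> unfolding connected_component_def by blast
    ultimately show "C \<in> {?c x}"
      using connected_component_eq[of y "A \<union> B" x] by simp
  qed
  have fin: "finite (?c ` X)" if "connected X" "X \<subseteq> A \<union> B" for X
  proof (cases "X = {}")
    case False
    then obtain x where "x \<in> X" by blast
    show ?thesis by (rule finite_subset[OF const[OF that \<open>x \<in> X\<close>]]) simp
  qed simp
  show ?thesis
    unfolding components_def image_Un using fin[OF assms(1)] fin[OF assms(2)] by simp
qed

text \<open>The hypothesis \<open>c \<le> d\<close> makes the interval nonempty;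
  \<open>infdist\<close> to the empty set is 0 by convention.\<close>

lemma infdist_Icc_eq_0_iff:
  fixes c d x :: real
  assumes "c \<le> d"
  shows "infdist x {c..d} = 0 \<longleftrightarrow> x \<in> {c..d}"
  using assms in_closed_iff_infdist_zero[of "{c..d}" x] by auto

lemma overflow_Icc_eq_0_imp_subset:
  fixes u v c d :: real
  assumes "c \<le> d" and zero: "overflow {u..v} {c..d} = 0"
  shows "{u..v} \<subseteq> {c..d}"
proof (rule ccontr)
  let ?S = "{u..v} - {c..d}"
  assume "\<not> {u..v} \<subseteq> {c..d}"
  then obtain x where x: "x \<in> ?S" by blast
  define C where "C = connected_component_set ?S x"
  have C: "C \<in> components ?S" "x \<in> C" "connected C" "C \<subseteq> ?S"
    using x connected_component_subset[of ?S x]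
    by (auto simp: C_def componentsI connected_component_refl)
  \<comment> \<open>The parts of \<open>{u..v}\<close> below \<open>c\<close> and above
    \<open>d\<close> are intervals, possibly empty.\<close>
  have "?S = ({u..v} \<inter> {..<c}) \<union> ({u..v} \<inter> {d<..})" using \<open>c \<le> d\<close> by auto
  moreover have "connected ({u..v} \<inter> {..<c})" "connected ({u..v} \<inter> {d<..})"
    by (auto simp: connected_iff_interval)
  ultimately have "finite (components ?S)"
    using finite_components_Un_connected by metis
  then have "infdist ((Inf C + Sup C) / 2) {c..d} = 0"
    using zero C(1) unfolding overflow_def by (simp add: sum_nonneg_eq_0_iff infdist_nonneg)
  then have mid: "c \<le> (Inf C + Sup C) / 2" "(Inf C + Sup C) / 2 \<le> d"
    using infdist_Icc_eq_0_iff[OF \<open>c \<le> d\<close>] by auto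
  \<comment> \<open>Only for bounded \<open>C\<close> are \<open>Inf C\<close> and
    \<open>Sup C\<close> known to enclose its points.\<close>
  have bdd: "bdd_below C" "bdd_above C"
    using C(4) by (auto intro: bdd_below_mono[of "{u..v}"] bdd_above_mono[of "{u..v}"])
  then have x_bounds: "Inf C \<le> x" "x \<le> Sup C"
    using C(2) by (auto intro: cInf_lower cSup_upper)
  have between: "z \<in> C" if "y \<in> C" "w \<in> C" "y \<le> z" "z \<le> w" for y z w
    using connected_contains_Icc[OF C(3) that(1,2)] that(3,4) by auto
  consider "x < c" | "d < x" using x by fastforce
  then show False
  proof cases
    case 1
    \<comment> \<open>If \<open>y\<close> exceeded \<open>c\<close>, then \<open>c\<close> would lie
      between \<open>x\<close> and \<open>y\<close>, hence in \<open>C\<close>, which avoids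
      \<open>{c..d}\<close>.\<close>
    have "y \<le> c" if "y \<in> C" for y
      using between[OF C(2) that, of c] 1 C(4) \<open>c \<le> d\<close> by fastforce
    then have "Sup C \<le> c" using C(2) by (intro cSup_least) auto
    \<comment> \<open>The midpoint is strictly below \<open>c\<close>, since
      \<open>Inf C \<le> x < c\<close> and \<open>Sup C \<le> c\<close>.\<close>
    then show False using mid(1) x_bounds(1) 1 by simp
  next
    case 2
    have "d \<le> y" if "y \<in> C" for y
      using between[OF that C(2), of d] 2 C(4) \<open>c \<le> d\<close> by fastforce
    then have "d \<le> Inf C" using C(2) by (intro cInf_greatest) auto
    then show False using mid(2) x_bounds(2) 2 by simp
  qed
qed

lemma symbolic_tolerance_loss_eq_0D:
  assumes "finite D" and "symbolic_tolerance_loss n D \<Delta> a b = 0"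
    and "(inp, lb) \<in> D" and "j < n"
  shows "symbolic_loss \<Delta> j (a inp lb) (b inp lb) lb = 0"
proof -
  let ?t = "\<lambda>(inp, lb). \<Sum>j<n. (symbolic_loss \<Delta> j (a inp lb) (b inp lb) lb)\<^sup>2"
  \<comment> \<open>If the cardinality were 0, division by zero would make the loss 0 whatever the
    sum.\<close>
  have "card D \<noteq> 0" using assms(1,3) by auto
  then have "sum ?t D = 0" using assms(2) unfolding symbolic_tolerance_loss_def by simp
  moreover have "\<forall>p\<in>D. 0 \<le> ?t p" by (auto intro: sum_nonneg)
  ultimately have "?t (inp, lb) = 0"
    using assms(1,3) sum_nonneg_eq_0_iff[of D ?t] by blast
  then show ?thesis using assms(4) by (simp add: sum_nonneg_eq_0_iff)
qed

text \<open>The list of layers \<open>[1..<Suc L]\<close> splits at \<open>l\<close>; for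
  \<open>l = 1\<close> the first part is empty.\<close>

lemma layers_net_out:
  assumes "1 \<le> l" "l \<le> L"
  shows "layers g l L (net_out g (l - 1) v) = net_out g L v"
  using assms upt_add_eq_append[of 1 l "Suc L - l"] by (simp add: net_out_def layers_def)

lemma net_out_carrier:
  assumes "neural_network L d g" "v \<in> carrier_vec (d 0)" "m \<le> L"
  shows "net_out g m v \<in> carrier_vec (d m)"
  using assms(3)
proof (induction m)
  case 0
  then show ?case using assms(2) by (simp add: net_out_def layers_def)
next
  case (Suc m)
  have "g (Suc m) \<in> carrier_vec (d m) \<rightarrow> carrier_vec (d (Suc m))"
    using assms(1) Suc.prems unfolding neural_network_def by force
  moreover have "net_out g (Suc m) v = g (Suc m) (net_out g m v)"
    by (simp add: net_out_def layers_def)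
  ultimately show ?case using Suc by (simp add: Pi_iff)
qed

theorem lemma5:
  fixes L l :: nat
    and d :: "nat \<Rightarrow> nat"
    and g :: "nat \<Rightarrow> real vec \<Rightarrow> real vec"
    and D :: "(real vec \<times> real vec) set"
    and \<Delta> :: "real vec"
    and \<kappa> :: real
    and a b :: "real vec \<Rightarrow> real vec \<Rightarrow> real vec"
  assumes "neural_network L d g"
    and "finite D" and "D \<noteq> {}" and "D \<subseteq> carrier_vec (d 0) \<times> carrier_vec (d L)"
    and "\<Delta> \<in> carrier_vec (d L)" and "\<forall>j<d L. \<Delta> $ j \<ge> 0"
    and "l \<in> {1..L}" and "\<kappa> \<ge> 0"
    and "\<forall>(inp, lb)\<in>D. output_bound L d g l \<kappa> inp (a inp lb) (b inp lb)"
    and "symbolic_tolerance_loss (d L) D \<Delta> a b = 0"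
  shows "\<forall>inp'\<in>carrier_vec (d 0). \<forall>(inp, lb)\<in>D.
           net_out g (l - 1) inp' \<in> feature_box g l \<kappa> inp \<longrightarrow>
           net_out g L inp' \<in> {lb + - \<Delta> .. lb + \<Delta>}"
proof (intro ballI, clarify)
  fix inp' inp lb
  assume inp': "inp' \<in> carrier_vec (d 0)" and D: "(inp, lb) \<in> D"
    and box: "net_out g (l - 1) inp' \<in> feature_box g l \<kappa> inp"
  let ?y = "net_out g L inp'"
  \<comment> \<open>The order on vectors also compares dimensions, so box membership needs the
    dimension of the output.\<close>
  have y: "?y \<in> carrier_vec (d L)" using net_out_carrier[OF assms(1) inp'] by blast
  have lb: "lb \<in> carrier_vec (d L)" using assms(4) D by blast
  have "lb $ j - \<Delta> $ j \<le> ?y $ j \<and> ?y $ j \<le> lb $ j + \<Delta> $ j" if j: "j < d L" for j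
  proof -
    have "output_bound L d g l \<kappa> inp (a inp lb) (b inp lb)" using assms(9) D by blast
    \<comment> \<open>The features of \<open>inp'\<close> are themselves one of the perturbed
      vectors \<open>fv\<close> that the output bound of \<open>inp\<close> covers.\<close>
    then have "layers g l L (net_out g (l - 1) inp') $ j \<in> {a inp lb $ j .. b inp lb $ j}"
      using box j unfolding output_bound_def by blast
    then have "?y $ j \<in> {a inp lb $ j .. b inp lb $ j}"
      using layers_net_out[of l L] assms(7) by simp
    moreover have "{a inp lb $ j .. b inp lb $ j} \<subseteq> {lb $ j - \<Delta> $ j .. lb $ j + \<Delta> $ j}"
      using symbolic_tolerance_loss_eq_0D[OF assms(2,10) D j] assms(6) j
      unfolding symbolic_loss_def by (intro overflow_Icc_eq_0_imp_subset) auto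
    ultimately show ?thesis by (meson atLeastAtMost_iff subsetD)
  qed
  then show "?y \<in> {lb + - \<Delta> .. lb + \<Delta>}"
    using y lb assms(5) by (subst vec_box_iff) auto
qed

end
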